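(* Let $i\in\mathcal{V}_{g2}$ be a generator with second-order turbine-governor dynamics and controller $$T_{si}\dot P_{si}=-P_{si}-K_i^{-1}\omega_{gi}+\theta_i,\qquad T_{mi}\dot P_{mi}=-P_{mi}+P_{si},\qquad T_{\theta_i}\dot\theta_i=-\theta_i+P_{si}-(1-K_i^{-1})\omega_{gi}.$$ There exists a positive definite storage function $Z_{2i}(P_{si},\overline P_{si}^{opt},P_{mi},\overline P_{mi}^{opt},\theta_i,\overline\theta_i^{opt})$ which satisfies, along the solutions of the power network dynamics (see context) interconnected with the second-order turbine-governor dynamics $T_{si}\dot P_{si}=-P_{si}-K_i^{-1}\omega_{gi}+\theta_i$, $T_{mi}\dot P_{mi}=-P_{mi}+P_{si}$ and the controller $T_{\theta_i}\dot\theta_i=-\theta_i+P_{si}-(1-K_i^{-1})\omega_{gi}$ at generator $i$, $$\dot U_{gi}+\dot Z_{2i}=\begin{bmatrix}\omega_{gi}\\ P_{si}-P_{mi}\\ P_{si}-\theta_i\end{bmatrix}^TW_i\begin{bmatrix}\omega_{gi}\\ P_{si}-P_{mi}\\ P_{si}-\theta_i\end{bmatrix},$$ where $\dot U_{gi}:=-D_{gi}\omega_{gi}^2+\omega_{gi}(P_{mi}-\overline P_{mi}^{opt})$ and $$W_i=\begin{bmatrix}-D_{gi}&-\tfrac12K_i^{-1}-\tfrac12&-\tfrac12K_i^{-1}+\tfrac12\\ -\tfrac12K_i^{-1}-\tfrac12&-T_{si}T_{mi}^{-1}&-\tfrac12\\ -\tfrac12K_i^{-1}+\tfrac12&-\t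frac12&-1\end{bmatrix}.$$
   Context: Network. The power network is a connected undirected graph with generator buses $\mathcal{V}_g=\{1,\dots,n_g\}$, load buses $\mathcal{V}_l=\{n_g+1,\dots,n\}$, $n=n_g+n_l$, and $m$ edges; $\mathcal{V}_{g2}\subseteq\mathcal{V}_g$ is the set of generators with second-order turbine-governors. $\mathcal{B}\in\mathbb{R}^{n\times m}$ is the incidence matrix, with row blocks $\mathcal{B}_g,\mathcal{B}_l$ indexed by $\mathcal{V}_g,\mathcal{V}_l$. $\Gamma=\mathrm{diag}(\gamma_1,\dots,\gamma_m)$ with $\gamma_k>0$; $M,D_g,D_l$ are diagonal with positive entries $M_i,D_{gi},D_{li}$; $\sin(\cdot)$ acts componentwise. The power network dynamics are $$\dot\eta=\mathcal{B}^T\omega,\qquad M\dot\omega_g=-D_g\omega_g-\mathcal{B}_g\Gamma\sin(\eta)+P_m,\qquad \boldsymbol 0=-D_l\omega_l-\mathcal{B}_l\Gamma\sin(\eta)-P_l,$$ with $\omega=(\omega_g^T,\omega_l^T)^T$ and constant $P_l\in\mathbb{R}^{n_l}$. The constants $T_{si},T_{mi},T_{\theta_i},K_i$ are positive. Optimal values. $\overline P_m^{opt}\in\mathbb{R}^{n_g}$ is the unique minimizer of $C(P_m)=\sum_{i\in\mathcal{V}_g}(\tfrac12q_iP_{mi}^2+r_iP_{mi}+s_i)$, $q_i>0$, subject to $0=\mathbb{1}_{n_g}^TP_m-\mathbb{1}_{n_l}^TP_l$ ($\mathbb{1}$ the all-ones vector). The steady state values of the turbine-governor and controller (at zero frequency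 deviation) satisfy $0=-\overline P_{si}^{opt}+\overline\theta_i^{opt}$, $0=-\overline P_{mi}^{opt}+\overline P_{si}^{opt}$, i.e. $\overline P_{si}^{opt}=\overline\theta_i^{opt}=\overline P_{mi}^{opt}$. "Positive definite" means: as a function of $(P_{si},P_{mi},\theta_i)$, $Z_{2i}$ vanishes at $(\overline P_{si}^{opt},\overline P_{mi}^{opt},\overline\theta_i^{opt})$ and is positive elsewhere. $\dot U_{gi}$ is merely notation for the stated expression; $\dot Z_{2i}$ is the derivative of $Z_{2i}$ along solutions. *)

theory Defs
  imports "HOL-Analysis.Analysis" "Graph_Theory.Graph_Theory"
begin

text \<open>
  Vectors in \<open>\<real>\<^sup>k\<close> are functions \<open>nat \<Rightarrow> real\<close> of which only the entries at the relevant buses or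
  edges matter; a diagonal matrix is given by its diagonal. Load quantities are indexed by the
  bus number, i.e. by \<open>n\<^sub>g + 1, \<dots>, n\<^sub>g + n\<^sub>l\<close>.

  The undirected network graph is given together with the orientation of its edges that underlies
  the incidence matrix: every undirected edge is represented by exactly one arc.
\<close>

record power_network =
  n_gen :: nat
  n_load :: nat
  n_edge :: nat
  graph :: "(nat, nat) pre_digraph"
  gam :: "nat \<Rightarrow> real"
  inertia :: "nat \<Rightarrow> real"
  damp_gen :: "nat \<Rightarrow> real"
  damp_load :: "nat \<Rightarrow> real"

definition gens :: "power_network \<Rightarrow> nat set" where
  "gens N = {1..n_gen N}"

definition loads :: "power_network \<Rightarrow> nat set" where
  "loads N = {n_gen N + 1..n_gen N + n_load N}"

definition buses :: "power_network \<Rightarrow> nat set" where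
  "buses N = {1..n_gen N + n_load N}"

definition edges :: "power_network \<Rightarrow> nat set" where
  "edges N = {1..n_edge N}"

text \<open>
  The locale predicate \<^const>\<open>digraph\<close> excludes loops and equally directed parallel arcs; the
  last condition on the graph excludes pairs of opposite arcs, so that the underlying undirected
  graph is simple. \<^const>\<open>Digraph_Component.connected\<close> is connectedness of that undirected graph.
\<close>

definition valid_network :: "power_network \<Rightarrow> bool" where
  "valid_network N \<longleftrightarrow>
     verts (graph N) = buses N \<and> arcs (graph N) = edges N \<and>
     digraph (graph N) \<and> Digraph_Component.connected (graph N) \<and>
     (\<forall>e \<in> edges N. \<forall>f \<in> edges N.
        \<not> (tail (graph N) e = head (graph N) f \<and> head (graph N) e = tail (graph N) f)) \<and>
     (\<forall>k \<in> edges N. gam N k > 0) \<and>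
     (\<forall>i \<in> gens N. inertia N i > 0 \<and> damp_gen N i > 0) \<and>
     (\<forall>i \<in> loads N. damp_load N i > 0)"

definition incidence :: "power_network \<Rightarrow> nat \<Rightarrow> nat \<Rightarrow> real" where
  "incidence N i k =
     (if i = tail (graph N) k then 1 else if i = head (graph N) k then - 1 else 0)"

definition line_flow :: "power_network \<Rightarrow> (nat \<Rightarrow> real) \<Rightarrow> nat \<Rightarrow> real" where
  "line_flow N \<eta> i = (\<Sum>k \<in> edges N. incidence N i k * (gam N k * sin (\<eta> k)))"

definition time_interval :: "real set \<Rightarrow> bool" where
  "time_interval J \<longleftrightarrow> is_interval J \<and> (\<exists>a \<in> J. \<exists>b \<in> J. a < b)"

text \<open>
  The mechanical powers \<open>P\<^sub>m\<close> enter the network as inputs, so the generation side of the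
  generators is left open here.
\<close>

definition network_dynamics ::
  "power_network \<Rightarrow> (nat \<Rightarrow> real) \<Rightarrow> real set \<Rightarrow> (real \<Rightarrow> nat \<Rightarrow> real) \<Rightarrow>
   (real \<Rightarrow> nat \<Rightarrow> real) \<Rightarrow> (real \<Rightarrow> nat \<Rightarrow> real) \<Rightarrow> bool" where
  "network_dynamics N P\<^sub>l J \<eta> \<omega> P\<^sub>m \<longleftrightarrow> (\<forall>t \<in> J.
     (\<forall>k \<in> edges N. ((\<lambda>\<tau>. \<eta> \<tau> k) has_real_derivative
        (\<Sum>j \<in> buses N. incidence N j k * \<omega> t j)) (at t within J)) \<and>
     (\<forall>j \<in> gens N. \<exists>d\<omega>. ((\<lambda>\<tau>. \<omega> \<tau> j) has_real_derivative d\<omega>) (at t within J) \<and>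
        inertia N j * d\<omega> = - damp_gen N j * \<omega> t j - line_flow N (\<eta> t) j + P\<^sub>m t j) \<and>
     (\<forall>j \<in> loads N. 0 = - damp_load N j * \<omega> t j - line_flow N (\<eta> t) j - P\<^sub>l j))"

definition governor_dynamics ::
  "real \<Rightarrow> real \<Rightarrow> real \<Rightarrow> real set \<Rightarrow> (real \<Rightarrow> real) \<Rightarrow> (real \<Rightarrow> real) \<Rightarrow> (real \<Rightarrow> real) \<Rightarrow>
   (real \<Rightarrow> real) \<Rightarrow> bool" where
  "governor_dynamics T\<^sub>s T\<^sub>m K J \<omega> p\<^sub>s p\<^sub>m \<theta> \<longleftrightarrow> (\<forall>t \<in> J. \<exists>dp\<^sub>s dp\<^sub>m.
     (p\<^sub>s has_real_derivative dp\<^sub>s) (at t within J) \<and>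
     (p\<^sub>m has_real_derivative dp\<^sub>m) (at t within J) \<and>
     T\<^sub>s * dp\<^sub>s = - p\<^sub>s t - inverse K * \<omega> t + \<theta> t \<and>
     T\<^sub>m * dp\<^sub>m = - p\<^sub>m t + p\<^sub>s t)"

definition controller_dynamics ::
  "real \<Rightarrow> real \<Rightarrow> real set \<Rightarrow> (real \<Rightarrow> real) \<Rightarrow> (real \<Rightarrow> real) \<Rightarrow> (real \<Rightarrow> real) \<Rightarrow> bool" where
  "controller_dynamics T\<^sub>\<theta> K J \<omega> p\<^sub>s \<theta> \<longleftrightarrow> (\<forall>t \<in> J. \<exists>d\<theta>.
     (\<theta> has_real_derivative d\<theta>) (at t within J) \<and>
     T\<^sub>\<theta> * d\<theta> = - \<theta> t + p\<^sub>s t - (1 - inverse K) * \<omega> t)"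

definition gen_cost ::
  "power_network \<Rightarrow> (nat \<Rightarrow> real) \<Rightarrow> (nat \<Rightarrow> real) \<Rightarrow> (nat \<Rightarrow> real) \<Rightarrow> (nat \<Rightarrow> real) \<Rightarrow> real" where
  "gen_cost N q r s P = (\<Sum>i \<in> gens N. 1 / 2 * q i * (P i)\<^sup>2 + r i * P i + s i)"

definition balanced :: "power_network \<Rightarrow> (nat \<Rightarrow> real) \<Rightarrow> (nat \<Rightarrow> real) \<Rightarrow> bool" where
  "balanced N P\<^sub>l P \<longleftrightarrow> 0 = (\<Sum>i \<in> gens N. P i) - (\<Sum>i \<in> loads N. P\<^sub>l i)"

definition W_mat :: "real \<Rightarrow> real \<Rightarrow> real \<Rightarrow> real \<Rightarrow> real^3^3" where
  "W_mat D\<^sub>g T\<^sub>s T\<^sub>m K = vector [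
     vector [- D\<^sub>g, - (1/2) * inverse K - 1/2, - (1/2) * inverse K + 1/2],
     vector [- (1/2) * inverse K - 1/2, - T\<^sub>s * inverse T\<^sub>m, - (1/2)],
     vector [- (1/2) * inverse K + 1/2, - (1/2), - 1]]"

end

theory Submission
  imports Defs
begin

text \<open>
  In deviations \<open>x = P\<^sub>s\<close>, \<open>y = P\<^sub>m\<close>, \<open>z = \<theta>\<close> from the common optimal value, the coefficient of
  \<open>\<omega>\<close> in the derivative of a quadratic \<open>Z\<close> is \<open>- Z\<^sub>x / (K T\<^sub>s) - (1 - 1/K) Z\<^sub>z / T\<^sub>\<theta>\<close>. Matching it
  with the required \<open>- (2 x - y) / K - (1 - 1/K) z\<close> for every \<open>K\<close> forces \<open>Z\<^sub>x = T\<^sub>s (2 x - y)\<close> and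
  \<open>Z\<^sub>z = T\<^sub>\<theta> z\<close>; the \<open>y\<^sup>2\<close> term is then fixed by the entry \<open>- T\<^sub>s / T\<^sub>m\<close> of \<open>W\<close>, and the result is a
  positive combination of \<open>x\<^sup>2\<close>, \<open>(x - y)\<^sup>2\<close> and \<open>z\<^sup>2\<close>.
\<close>

definition storage :: "real \<Rightarrow> real \<Rightarrow> real \<Rightarrow> real \<Rightarrow> real \<Rightarrow> real" where
  "storage T\<^sub>s T\<^sub>\<theta> x y z = T\<^sub>s / 2 * (x\<^sup>2 + (x - y)\<^sup>2) + T\<^sub>\<theta> / 2 * z\<^sup>2"

lemma storage_zero [simp]: "storage T\<^sub>s T\<^sub>\<theta> 0 0 0 = 0"
  by (simp add: storage_def)

text \<open>The squares \<open>x\<^sup>2\<close> and \<open>(x - y)\<^sup>2\<close> vanish together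
  only at x = y = 0, so the first summand is definite in (x, y); the \<open>z\<^sup>2\<close> term
  covers the remaining direction.\<close>

lemma storage_pos:
  assumes "T\<^sub>s > 0" "T\<^sub>\<theta> > 0" "(x, y, z) \<noteq> (0, 0, 0)"
  shows "storage T\<^sub>s T\<^sub>\<theta> x y z > 0"
proof (cases "z = 0")
  case True
  with assms have "x\<^sup>2 + (x - y)\<^sup>2 > 0"
    by (auto simp: sum_power2_gt_zero_iff)
  with True assms show ?thesis
    by (simp add: storage_def)
next
  case False
  with assms show ?thesis
    unfolding storage_def by (intro add_nonneg_pos mult_nonneg_nonneg mult_pos_pos) auto
qed

text \<open>By symmetry each halved off-diagonal entry is counted twice. This reduces the matrix
  identity to one between polynomials.\<close>

lemma W_mat_quadratic_form:
  "(vector [a, b, c] :: real^3) \<bullet> (W_mat D T\<^sub>s T\<^sub>m K *v vector [a, b, c]) =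
     - D * a\<^sup>2 - (inverse K + 1) * a * b + (1 - inverse K) * a * c
     - T\<^sub>s * inverse T\<^sub>m * b\<^sup>2 - b * c - c\<^sup>2"
  by (simp add: W_mat_def inner_vec_def matrix_vector_mult_def sum_3 vector_3
      power2_eq_square algebra_simps)

text \<open>The products \<open>T\<^sub>s * dp\<^sub>s\<close> and
  \<open>T\<^sub>\<theta> * d\<theta>\<close> are kept whole because they are the left sides of the
  governor and controller equations, ready to be substituted.\<close>

lemma storage_derivative:
  assumes "(p\<^sub>s has_real_derivative dp\<^sub>s) (at t within J)"
    and "(p\<^sub>m has_real_derivative dp\<^sub>m) (at t within J)"
    and "(\<theta> has_real_derivative d\<theta>) (at t within J)"
  shows "((\<lambda>\<tau>. storage T\<^sub>s T\<^sub>\<theta> (p\<^sub>s \<tau> - a) (p\<^sub>m \<tau> - b) (\<theta> \<tau> - c)) has_real_derivative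
      (2 * (p\<^sub>s t - a) - (p\<^sub>m t - b)) * (T\<^sub>s * dp\<^sub>s)
      + T\<^sub>s * ((p\<^sub>m t - b) - (p\<^sub>s t - a)) * dp\<^sub>m + (\<theta> t - c) * (T\<^sub>\<theta> * d\<theta>)) (at t within J)"
  unfolding storage_def
  by (auto intro!: derivative_eq_intros assms simp: field_simps)

text \<open>All deviations are taken from one value \<open>a\<close>. The equations contain the
  powers only through differences, so a common shift leaves their right sides unchanged, and the
  terms in \<open>a\<close> cancel on the left.\<close>

lemma storage_balance:
  assumes "T\<^sub>m \<noteq> 0"
    and "T\<^sub>s * dp\<^sub>s = - p\<^sub>s - inverse K * w + \<theta>"
    and "T\<^sub>m * dp\<^sub>m = - p\<^sub>m + p\<^sub>s"
    and "T\<^sub>\<theta> * d\<theta> = - \<theta> + p\<^sub>s - (1 - inverse K) * w"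
  shows "- D * w\<^sup>2 + w * (p\<^sub>m - a) +
      ((2 * (p\<^sub>s - a) - (p\<^sub>m - a)) * (T\<^sub>s * dp\<^sub>s)
        + T\<^sub>s * ((p\<^sub>m - a) - (p\<^sub>s - a)) * dp\<^sub>m + (\<theta> - a) * (T\<^sub>\<theta> * d\<theta>)) =
    (vector [w, p\<^sub>s - p\<^sub>m, p\<^sub>s - \<theta>] :: real^3) \<bullet>
      (W_mat D T\<^sub>s T\<^sub>m K *v vector [w, p\<^sub>s - p\<^sub>m, p\<^sub>s - \<theta>])"
proof -
  \<comment> \<open>The \<open>y\<close> part of the gradient carries \<open>T\<^sub>s\<close>, not
    \<open>T\<^sub>m\<close>, so here one has to divide; this yields the entry
    \<open>- T\<^sub>s * inverse T\<^sub>m\<close>.\<close>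
  have dp\<^sub>m: "dp\<^sub>m = inverse T\<^sub>m * (p\<^sub>s - p\<^sub>m)"
    using assms(1,3) by (simp add: field_simps)
  show ?thesis
    unfolding W_mat_quadratic_form assms(2,4) dp\<^sub>m
    by (simp add: power2_eq_square algebra_simps)
qed

theorem lemma6:
  fixes N :: power_network and V\<^sub>g\<^sub>2 :: "nat set" and i :: nat
    and T\<^sub>s T\<^sub>m T\<^sub>\<theta> K :: "nat \<Rightarrow> real"
    and q r s P\<^sub>l :: "nat \<Rightarrow> real"
    and Pm_opt Ps_opt \<theta>_opt :: "nat \<Rightarrow> real"
  assumes "valid_network N"
    and "V\<^sub>g\<^sub>2 \<subseteq> gens N" and "i \<in> V\<^sub>g\<^sub>2"
    and "\<forall>j \<in> V\<^sub>g\<^sub>2. T\<^sub>s j > 0 \<and> T\<^sub>m j > 0 \<and> T\<^sub>\<theta> j > 0 \<and> K j > 0"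
    and "\<forall>j \<in> gens N. q j > 0"
    and "is_arg_min (gen_cost N q r s) (balanced N P\<^sub>l) Pm_opt"
    and "\<forall>j \<in> V\<^sub>g\<^sub>2. 0 = - Ps_opt j + \<theta>_opt j \<and> 0 = - Pm_opt j + Ps_opt j"
  shows "\<exists>Z :: real \<Rightarrow> real \<Rightarrow> real \<Rightarrow> real \<Rightarrow> real \<Rightarrow> real \<Rightarrow> real.
    Z (Ps_opt i) (Ps_opt i) (Pm_opt i) (Pm_opt i) (\<theta>_opt i) (\<theta>_opt i) = 0 \<and>
    (\<forall>p\<^sub>s p\<^sub>m \<theta>. (p\<^sub>s, p\<^sub>m, \<theta>) \<noteq> (Ps_opt i, Pm_opt i, \<theta>_opt i) \<longrightarrow>
       Z p\<^sub>s (Ps_opt i) p\<^sub>m (Pm_opt i) \<theta> (\<theta>_opt i) > 0) \<and>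
    (\<forall>J \<eta> \<omega> P\<^sub>m p\<^sub>s \<theta>.
       time_interval J \<and>
       network_dynamics N P\<^sub>l J \<eta> \<omega> P\<^sub>m \<and>
       governor_dynamics (T\<^sub>s i) (T\<^sub>m i) (K i) J (\<lambda>t. \<omega> t i) p\<^sub>s (\<lambda>t. P\<^sub>m t i) \<theta> \<and>
       controller_dynamics (T\<^sub>\<theta> i) (K i) J (\<lambda>t. \<omega> t i) p\<^sub>s \<theta> \<longrightarrow>
       (\<forall>t \<in> J. \<exists>dZ.
          ((\<lambda>\<tau>. Z (p\<^sub>s \<tau>) (Ps_opt i) (P\<^sub>m \<tau> i) (Pm_opt i) (\<theta> \<tau>) (\<theta>_opt i))
             has_real_derivative dZ) (at t within J) \<and>
          (let \<omega>\<^sub>i = \<omega> t i;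
               dU = - damp_gen N i * \<omega>\<^sub>i\<^sup>2 + \<omega>\<^sub>i * (P\<^sub>m t i - Pm_opt i);
               v = (vector [\<omega>\<^sub>i, p\<^sub>s t - P\<^sub>m t i, p\<^sub>s t - \<theta> t] :: real^3)
           in dU + dZ = v \<bullet> (W_mat (damp_gen N i) (T\<^sub>s i) (T\<^sub>m i) (K i) *v v))))"
proof -
  have pos: "T\<^sub>s i > 0" "T\<^sub>m i > 0" "T\<^sub>\<theta> i > 0"
    using assms(3,4) by auto
  have opt: "Ps_opt i = Pm_opt i" "\<theta>_opt i = Pm_opt i"
    using assms(3,7) by auto
  let ?Z = "\<lambda>p\<^sub>s a p\<^sub>m b \<theta> c. storage (T\<^sub>s i) (T\<^sub>\<theta> i) (p\<^sub>s - a) (p\<^sub>m - b) (\<theta> - c)"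
  show ?thesis
  proof (rule exI [of _ ?Z], intro conjI allI impI ballI)
    show "?Z (Ps_opt i) (Ps_opt i) (Pm_opt i) (Pm_opt i) (\<theta>_opt i) (\<theta>_opt i) = 0"
      by simp
  next
    fix p\<^sub>s p\<^sub>m \<theta>
    assume "(p\<^sub>s, p\<^sub>m, \<theta>) \<noteq> (Ps_opt i, Pm_opt i, \<theta>_opt i)"
    then show "?Z p\<^sub>s (Ps_opt i) p\<^sub>m (Pm_opt i) \<theta> (\<theta>_opt i) > 0"
      using pos by (intro storage_pos) auto
  next
    fix J \<eta> \<omega> P\<^sub>m p\<^sub>s \<theta> t
    assume "time_interval J \<and> network_dynamics N P\<^sub>l J \<eta> \<omega> P\<^sub>m \<and>
        governor_dynamics (T\<^sub>s i) (T\<^sub>m i) (K i) J (\<lambda>t. \<omega> t i) p\<^sub>s (\<lambda>t. P\<^sub>m t i) \<theta> \<and>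
        controller_dynamics (T\<^sub>\<theta> i) (K i) J (\<lambda>t. \<omega> t i) p\<^sub>s \<theta>"
      and t: "t \<in> J"
    then obtain dp\<^sub>s dp\<^sub>m d\<theta> where
      deriv: "(p\<^sub>s has_real_derivative dp\<^sub>s) (at t within J)"
        "((\<lambda>t. P\<^sub>m t i) has_real_derivative dp\<^sub>m) (at t within J)"
        "(\<theta> has_real_derivative d\<theta>) (at t within J)"
      and ode: "T\<^sub>s i * dp\<^sub>s = - p\<^sub>s t - inverse (K i) * \<omega> t i + \<theta> t"
        "T\<^sub>m i * dp\<^sub>m = - P\<^sub>m t i + p\<^sub>s t"
        "T\<^sub>\<theta> i * d\<theta> = - \<theta> t + p\<^sub>s t - (1 - inverse (K i)) * \<omega> t i"
      unfolding governor_dynamics_def controller_dynamics_def by meson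
    have "T\<^sub>m i \<noteq> 0"
      using pos by simp
    \<comment> \<open>Neither \<open>D\<close> nor \<open>a\<close> occurs in the premises, so both
      are instantiated by hand.\<close>
    note balance = storage_balance [OF this ode, where D = "damp_gen N i" and a = "Pm_opt i"]
    show "\<exists>dZ. ((\<lambda>\<tau>. ?Z (p\<^sub>s \<tau>) (Ps_opt i) (P\<^sub>m \<tau> i) (Pm_opt i) (\<theta> \<tau>) (\<theta>_opt i))
          has_real_derivative dZ) (at t within J) \<and>
        (let \<omega>\<^sub>i = \<omega> t i;
             dU = - damp_gen N i * \<omega>\<^sub>i\<^sup>2 + \<omega>\<^sub>i * (P\<^sub>m t i - Pm_opt i);
             v = (vector [\<omega>\<^sub>i, p\<^sub>s t - P\<^sub>m t i, p\<^sub>s t - \<theta> t] :: real^3)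
         in dU + dZ = v \<bullet> (W_mat (damp_gen N i) (T\<^sub>s i) (T\<^sub>m i) (K i) *v v))"
      \<comment> \<open>Rewriting with \<open>opt\<close> turns the three reference values into the
        single \<open>a\<close> that \<open>balance\<close> expects.\<close>
      unfolding Let_def opt
      by (intro exI conjI, rule storage_derivative [OF deriv], rule balance)
  qed
qed

end
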